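(* Let $\lambda\in\mathbb{R}$ and let $\varphi:(p,q)\mapsto(P,Q)$ be a smooth mapping (defined locally in $\mathbb{R}^d\times\mathbb{R}^d$, with values in $\mathbb{R}^d\times\mathbb{R}^d$) that is close to the identity. Then $\varphi$ is symplectic if and only if there exists locally a function $S=S(u,v)$ of the variables $u=\lambda P+(1-\lambda)p$ and $v=\lambda q+(1-\lambda)Q$, i.e. $S\big(\lambda P+(1-\lambda)p,\ \lambda q+(1-\lambda)Q\big)$, such that $$(Q-q)^T\,d\big(\lambda P+(1-\lambda)p\big)-(P-p)^T\,d\big(\lambda q+(1-\lambda)Q\big)=dS .$$
   Context: Here $p,q,P,Q\in\mathbb{R}^d$, and $P=P(p,q)$, $Q=Q(p,q)$ are the components of $\varphi$; the displayed identity is an identity of differential one-forms in $(p,q)$, with $dP=P_p\,dp+P_q\,dq$, $dQ=Q_p\,dp+Q_q\,dq$. The map $\varphi$ is symplectic if its Jacobian $M=\partial(P,Q)/\partial(p,q)$ satisfies $M^TJM=J$ with $J=\begin{pmatrix}0&I_d\\-I_d&0\end{pmatrix}$; equivalently $P_p^TQ_p=Q_p^TP_p$, $Q_q^TP_q=P_q^TQ_q$, $Q_p^TP_q+I_d=P_p^TQ_q$. "Close to the identity" means that $\varphi$ and its Jacobian are sufficiently close (depending on $\lambda$) to the identity map and the identity matrix, so that in particular the Jacobian of $(p,q)\mapsto(u,v)$ is invertible. "Locally" means in a neighbourhood of each point of the domain. *)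

theory Defs
  imports "HOL-Analysis.Analysis"
begin

type_synonym 'd phase = "(real ^ 'd) \<times> (real ^ 'd)"

subsection \<open>Smooth functions\<close>

text \<open>
  For open \<open>X\<close> in a Euclidean space this says that \<open>f\<close> is \<open>n\<close> times continuously differentiable
  on \<open>X\<close>: all iterated directional derivatives up to order \<open>n\<close> exist and are continuous.
\<close>

fun ck_on :: "nat \<Rightarrow> 'a::euclidean_space set \<Rightarrow> ('a \<Rightarrow> 'b::real_normed_vector) \<Rightarrow> bool" where
  "ck_on 0 X f \<longleftrightarrow> continuous_on X f"
| "ck_on (Suc n) X f \<longleftrightarrow>
     (\<forall>x\<in>X. f differentiable (at x)) \<and>
     (\<forall>h. ck_on n X (\<lambda>x. frechet_derivative f (at x) h))"

definition smooth_on :: "'a::euclidean_space set \<Rightarrow> ('a \<Rightarrow> 'b::real_normed_vector) \<Rightarrow> bool" where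
  "smooth_on X f \<longleftrightarrow> (\<forall>n. ck_on n X f)"

subsection \<open>Jacobian matrix and symplectic maps\<close>

text \<open>
  The pair \<open>(p, q)\<close> corresponds to the column vector with upper block \<open>p\<close> (indices \<open>Inl i\<close>) and
  lower block \<open>q\<close> (indices \<open>Inr i\<close>).
\<close>

definition stack :: "'d::finite phase \<Rightarrow> real ^ ('d + 'd)" where
  "stack z = (\<chi> k. case k of Inl i \<Rightarrow> fst z $ i | Inr i \<Rightarrow> snd z $ i)"

definition unstack :: "real ^ ('d + 'd) \<Rightarrow> 'd::finite phase" where
  "unstack w = ((\<chi> i. w $ Inl i), (\<chi> i. w $ Inr i))"

definition phase_jacobian ::
    "('d::finite phase \<Rightarrow> 'd phase) \<Rightarrow> 'd phase \<Rightarrow> real ^ ('d + 'd) ^ ('d + 'd)" where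
  "phase_jacobian \<phi> z = jacobian (stack \<circ> \<phi> \<circ> unstack) (at (stack z))"

definition J_matrix :: "real ^ ('d::finite + 'd) ^ ('d + 'd)" where
  "J_matrix = (\<chi> k l. case (k, l) of
      (Inl i, Inr j) \<Rightarrow> if i = j then 1 else 0
    | (Inr i, Inl j) \<Rightarrow> if i = j then - 1 else 0
    | _ \<Rightarrow> 0)"

definition symplectic_on :: "'d::finite phase set \<Rightarrow> ('d phase \<Rightarrow> 'd phase) \<Rightarrow> bool" where
  "symplectic_on D \<phi> \<longleftrightarrow>
     (\<forall>z\<in>D. transpose (phase_jacobian \<phi> z) ** J_matrix ** phase_jacobian \<phi> z = J_matrix)"

definition close_to_identity_on ::
    "real \<Rightarrow> 'd::finite phase set \<Rightarrow> ('d phase \<Rightarrow> 'd phase) \<Rightarrow> bool" where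
  "close_to_identity_on \<epsilon> D \<phi> \<longleftrightarrow>
     (\<forall>z\<in>D. norm (\<phi> z - z) < \<epsilon> \<and> norm (phase_jacobian \<phi> z - mat 1) < \<epsilon>)"

subsection \<open>The variables \<open>u\<close>, \<open>v\<close> and the one-form\<close>

text \<open>With \<open>z = (p, q)\<close> and \<open>\<phi> z = (P, Q)\<close>.\<close>

definition u_var :: "real \<Rightarrow> ('d::finite phase \<Rightarrow> 'd phase) \<Rightarrow> 'd phase \<Rightarrow> real ^ 'd" where
  "u_var l \<phi> z = l *\<^sub>R fst (\<phi> z) + (1 - l) *\<^sub>R fst z"

definition v_var :: "real \<Rightarrow> ('d::finite phase \<Rightarrow> 'd phase) \<Rightarrow> 'd phase \<Rightarrow> real ^ 'd" where
  "v_var l \<phi> z = l *\<^sub>R snd z + (1 - l) *\<^sub>R snd (\<phi> z)"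

text \<open>
  The value of \<open>(Q - q)\<^sup>T du - (P - p)\<^sup>T dv\<close> at the point \<open>z\<close> on the tangent vector \<open>h = (dp, dq)\<close>.
\<close>

definition gen_form :: "real \<Rightarrow> ('d::finite phase \<Rightarrow> 'd phase) \<Rightarrow> 'd phase \<Rightarrow> 'd phase \<Rightarrow> real" where
  "gen_form l \<phi> z h =
     (snd (\<phi> z) - snd z) \<bullet> frechet_derivative (u_var l \<phi>) (at z) h
     - (fst (\<phi> z) - fst z) \<bullet> frechet_derivative (v_var l \<phi>) (at z) h"

text \<open>
  Local existence: near every point of \<open>D\<close> there is a smooth function \<open>S\<close> of \<open>(u, v)\<close>, defined on an
  open set \<open>W\<close> containing the values of \<open>(u, v)\<close>, such that the differential of
  \<open>z \<mapsto> S (u z, v z)\<close> is the above one-form.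
\<close>

definition locally_has_generating_function ::
    "real \<Rightarrow> 'd::finite phase set \<Rightarrow> ('d phase \<Rightarrow> 'd phase) \<Rightarrow> bool" where
  "locally_has_generating_function l D \<phi> \<longleftrightarrow>
     (\<forall>z0\<in>D. \<exists>U W. \<exists>S :: 'd phase \<Rightarrow> real.
        open U \<and> z0 \<in> U \<and> U \<subseteq> D \<and>
        open W \<and> (\<forall>z\<in>U. (u_var l \<phi> z, v_var l \<phi> z) \<in> W) \<and> smooth_on W S \<and>
        (\<forall>z\<in>U. ((\<lambda>z. S (u_var l \<phi> z, v_var l \<phi> z)) has_derivative gen_form l \<phi> z) (at z)))"

end

theory Submission
  imports Defs
begin

text \<open>
  Write \<open>w z = \<phi> z - z\<close> and \<open>g z = (u z, v z) = z + T (w z)\<close> with \<open>T (a, b) = (l a, (1 - l) b)\<close>. In terms of the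
  symplectic form \<open>\<omega>\<close> the one-form is \<open>h \<mapsto> - \<omega> (w z) (g' z h)\<close>. Its exterior derivative does not involve
  the symmetric second derivative of \<open>g\<close>, and since the \<open>l\<close>-dependent terms cancel it equals
  \<open>\<omega> (h, k) - \<omega> (\<phi>' z h, \<phi>' z k)\<close> up to sign; so the form is closed iff \<open>\<phi>\<close> is symplectic. If it is closed, then by
  the Poincare lemma it has a primitive \<open>f\<close> on every ball in \<open>D\<close>. For \<open>\<epsilon>\<close> small, \<open>g' z\<close> is within \<open>1/2\<close> of the
  identity, so \<open>g\<close> is a diffeomorphism from the ball onto an open set, and \<open>S = f \<circ> g\<^sup>-\<^sup>1\<close> is the generating function.
\<close>

subsection \<open>Calculus of smooth functions\<close>

text \<open>On an open set equal functions have equal derivatives at each point, whatever they do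
  elsewhere, so the induction can compare derivatives direction by direction.\<close>

lemma ck_on_cong:
  assumes "open X" "\<And>x. x \<in> X \<Longrightarrow> f x = g x" "ck_on n X f"
  shows "ck_on n X g"
  using assms(2,3)
proof (induction n arbitrary: f g)
  case 0
  then show ?case by (simp cong: continuous_on_cong)
next
  case (Suc n)
  have g: "(g has_derivative frechet_derivative f (at x)) (at x)" if "x \<in> X" for x
    using Suc.prems that assms(1)
    by (auto simp: frechet_derivative_works intro: has_derivative_transform_within_open)
  moreover have "ck_on n X (\<lambda>x. frechet_derivative g (at x) h)" for h
  proof (rule Suc.IH)
    show "frechet_derivative f (at x) h = frechet_derivative g (at x) h" if "x \<in> X" for x
      using frechet_derivative_at[OF g[OF that]] by simp
    show "ck_on n X (\<lambda>x. frechet_derivative f (at x) h)"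
      using Suc.prems by simp
  qed
  ultimately show ?case by (auto simp: differentiable_def)
qed

text \<open>By uniqueness of derivatives, an explicit formula \<open>f'\<close> may stand in for the
  chosen \<open>frechet_derivative\<close>. The inductions below raise the order with this
  rule.\<close>

lemma ck_on_SucI:
  assumes "open X" "\<And>x. x \<in> X \<Longrightarrow> (f has_derivative f' x) (at x)"
    and "\<And>h. ck_on n X (\<lambda>x. f' x h)"
  shows "ck_on (Suc n) X f"
proof -
  have "frechet_derivative f (at x) = f' x" if "x \<in> X" for x
    using frechet_derivative_at[OF assms(2)[OF that]] by simp
  then have "ck_on n X (\<lambda>x. frechet_derivative f (at x) h)" for h
    by (intro ck_on_cong[OF assms(1) _ assms(3)[of h]]) simp
  with assms(2) show ?thesis by (auto simp: differentiable_def)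
qed

lemma ck_on_Suc_has_derivative:
  assumes "ck_on (Suc n) X f" "x \<in> X"
  shows "(f has_derivative frechet_derivative f (at x)) (at x)"
  using assms by (simp add: frechet_derivative_works)

lemma ck_on_Suc_imp_ck_on: "ck_on (Suc n) X f \<Longrightarrow> ck_on n X f"
proof (induction n arbitrary: f)
  case 0
  then show ?case
    by (auto intro!: continuous_at_imp_continuous_on differentiable_imp_continuous_within)
next
  case (Suc n)
  then show ?case by simp
qed

lemma ck_on_subset: "ck_on n X f \<Longrightarrow> Y \<subseteq> X \<Longrightarrow> ck_on n Y f"
  by (induction n arbitrary: f) (auto intro: continuous_on_subset)

lemma ck_on_const: "ck_on n X (\<lambda>x. c)"
  by (induction n arbitrary: c) auto

lemma ck_on_bounded_linear:
  assumes "open X" "bounded_linear L" "ck_on n X f"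
  shows "ck_on n X (\<lambda>x. L (f x))"
  using assms(3)
proof (induction n arbitrary: f)
  case 0
  then show ?case using bounded_linear.continuous_on[OF assms(2)] by auto
next
  case (Suc n)
  show ?case
    by (rule ck_on_SucI[OF assms(1) bounded_linear.has_derivative[OF assms(2)]])
       (use Suc in \<open>auto simp: frechet_derivative_works\<close>)
qed

lemma ck_on_add:
  assumes "open X" "ck_on n X f" "ck_on n X g"
  shows "ck_on n X (\<lambda>x. f x + g x)"
  using assms(2,3)
proof (induction n arbitrary: f g)
  case 0
  then show ?case by (auto intro: continuous_intros)
next
  case (Suc n)
  show ?case
    by (rule ck_on_SucI[OF assms(1) has_derivative_add])
       (use Suc in \<open>auto simp: frechet_derivative_works\<close>)
qed

lemma ck_on_bilinear:
  assumes "open X" "bounded_bilinear b" "ck_on n X f" "ck_on n X g"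
  shows "ck_on n X (\<lambda>x. b (f x) (g x))"
  using assms(3,4)
proof (induction n arbitrary: f g)
  case 0
  then show ?case using bounded_bilinear.continuous_on[OF assms(2)] by auto
next
  case (Suc n)
  \<comment> \<open>Each term of the product rule keeps one factor undifferentiated, so the
    induction hypothesis is also applied to \<open>f\<close> and \<open>g\<close>
    themselves.\<close>
  have "ck_on n X f" "ck_on n X g"
    using Suc.prems by (auto intro: ck_on_Suc_imp_ck_on simp del: ck_on.simps)
  then show ?case
    by (intro ck_on_SucI[OF assms(1) bounded_bilinear.FDERIV[OF assms(2)]])
       (use Suc in \<open>auto simp: frechet_derivative_works intro!: ck_on_add[OF assms(1)]\<close>)
qed

lemma ck_on_sum:
  assumes "open X" "\<And>i. i \<in> I \<Longrightarrow> ck_on n X (f i)"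
  shows "ck_on n X (\<lambda>x. \<Sum>i\<in>I. f i x)"
  using assms(2)
  by (induction I rule: infinite_finite_induct) (auto intro: ck_on_const ck_on_add[OF assms(1)])

lemma ck_on_ident: "open X \<Longrightarrow> ck_on n X (\<lambda>x. x)"
  by (cases n) (auto intro!: ck_on_SucI[where f'="\<lambda>_ h. h"] ck_on_const simp del: ck_on.simps(2))

text \<open>Regularity of \<open>L\<close> is known only for fixed arguments. Expanding
  \<open>f x\<close> in the basis reduces the claim to a finite sum of products of scalar functions
  with \<open>L x b\<close>.\<close>

lemma ck_on_linear_family:
  fixes L :: "'a::euclidean_space \<Rightarrow> 'c::euclidean_space \<Rightarrow> 'b::real_normed_vector"
  assumes "open X" "\<And>x. x \<in> X \<Longrightarrow> linear (L x)" "\<And>h. ck_on n X (\<lambda>x. L x h)"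
    and "ck_on n X f"
  shows "ck_on n X (\<lambda>x. L x (f x))"
proof (rule ck_on_cong[OF assms(1)])
  show "ck_on n X (\<lambda>x. \<Sum>b\<in>Basis. (f x \<bullet> b) *\<^sub>R L x b)"
    by (intro ck_on_sum ck_on_bilinear[OF _ bounded_bilinear_scaleR]
        ck_on_bounded_linear[OF _ bounded_linear_inner_left] assms)
  show "(\<Sum>b\<in>Basis. (f x \<bullet> b) *\<^sub>R L x b) = L x (f x)" if "x \<in> X" for x
    using linear_sum[OF assms(2)[OF that], of "\<lambda>b. (f x \<bullet> b) *\<^sub>R b" Basis]
    by (simp add: linear_scale[OF assms(2)[OF that]] euclidean_representation)
qed

section \<open>Smoothness of all orders\<close>

lemma smooth_on_subset: "smooth_on X f \<Longrightarrow> Y \<subseteq> X \<Longrightarrow> smooth_on Y f"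
  by (auto simp: smooth_on_def intro: ck_on_subset)

lemma smooth_on_has_derivative:
  assumes "smooth_on X f" "x \<in> X"
  shows "(f has_derivative frechet_derivative f (at x)) (at x)"
  using assms ck_on_Suc_has_derivative unfolding smooth_on_def by blast

lemma smooth_on_frechet:
  "smooth_on X f \<Longrightarrow> smooth_on X (\<lambda>x. frechet_derivative f (at x) h)"
  unfolding smooth_on_def using ck_on.simps(2) by blast

lemma smooth_onI:
  assumes "open X" "\<And>x. x \<in> X \<Longrightarrow> (f has_derivative f' x) (at x)"
    and "\<And>h. smooth_on X (\<lambda>x. f' x h)"
  shows "smooth_on X f"
  using ck_on_SucI[OF assms(1,2)] assms(3) ck_on_Suc_imp_ck_on
  unfolding smooth_on_def by blast

lemma smooth_on_continuous: "smooth_on X f \<Longrightarrow> continuous_on X f"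
  unfolding smooth_on_def by (metis ck_on.simps(1))

lemma smooth_on_add: "open X \<Longrightarrow> smooth_on X f \<Longrightarrow> smooth_on X g \<Longrightarrow> smooth_on X (\<lambda>x. f x + g x)"
  by (simp add: smooth_on_def ck_on_add)

lemma smooth_on_bounded_linear:
  "open X \<Longrightarrow> bounded_linear L \<Longrightarrow> smooth_on X f \<Longrightarrow> smooth_on X (\<lambda>x. L (f x))"
  by (simp add: smooth_on_def ck_on_bounded_linear)

lemma smooth_on_bilinear:
  "open X \<Longrightarrow> bounded_bilinear b \<Longrightarrow> smooth_on X f \<Longrightarrow> smooth_on X g \<Longrightarrow> smooth_on X (\<lambda>x. b (f x) (g x))"
  by (simp add: smooth_on_def ck_on_bilinear)

lemma smooth_on_ident: "open X \<Longrightarrow> smooth_on X (\<lambda>x. x)"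
  by (simp add: smooth_on_def ck_on_ident)

lemma smooth_on_const: "smooth_on X (\<lambda>x. c)"
  by (simp add: smooth_on_def ck_on_const)

lemma smooth_on_cong:
  "open X \<Longrightarrow> (\<And>x. x \<in> X \<Longrightarrow> f x = g x) \<Longrightarrow> smooth_on X f \<Longrightarrow> smooth_on X g"
  unfolding smooth_on_def using ck_on_cong[of X f g] by blast

subsection \<open>Closed and exact one-forms\<close>

text \<open>Two applications of the mean value theorem over the parallelogram spanned by
  \<open>h\<close> and \<open>k\<close>: first along \<open>h\<close> to the difference of two
  opposite edges, then along \<open>k\<close> to the resulting difference of
  \<open>A\<close>.\<close>

lemma second_difference_mean_value:
  fixes f :: "'a::real_normed_vector \<Rightarrow> real"
  assumes f: "\<And>x. x \<in> U \<Longrightarrow> (f has_derivative A x) (at x)"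
    and A: "\<And>x h. x \<in> U \<Longrightarrow> ((\<lambda>x. A x h) has_derivative B x h) (at x)"
    and U: "cball z (norm h + norm k) \<subseteq> U"
  obtains x where "dist z x \<le> norm h + norm k"
    "f (z + h + k) - f (z + h) - f (z + k) + f z = B x h k"
proof -
  have small: "dist z (z + s *\<^sub>R h + r *\<^sub>R k) \<le> norm h + norm k"
    if "0 \<le> s" "s \<le> 1" "0 \<le> r" "r \<le> 1" for s r
  proof -
    have "norm (s *\<^sub>R h + r *\<^sub>R k) \<le> s * norm h + r * norm k"
      using that by (intro order_trans[OF norm_triangle_ineq]) simp
    also have "\<dots> \<le> 1 * norm h + 1 * norm k"
      using that by (intro add_mono mult_right_mono) auto
    finally have "dist (z + (s *\<^sub>R h + r *\<^sub>R k)) z \<le> norm h + norm k"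
      by (simp add: dist_norm)
    then show ?thesis by (simp add: dist_commute add.assoc)
  qed
  have inU: "z + s *\<^sub>R h + r *\<^sub>R k \<in> U"
    if "0 \<le> s" "s \<le> 1" "0 \<le> r" "r \<le> 1" for s r
    using small[OF that] U by auto
  define F where "F s r = f (z + s *\<^sub>R h + r *\<^sub>R k)" for s r
  have F: "((\<lambda>s. F s r) has_derivative (\<lambda>d. A (z + s *\<^sub>R h + r *\<^sub>R k) (d *\<^sub>R h))) (at s within T)"
    if "0 \<le> s" "s \<le> 1" "0 \<le> r" "r \<le> 1" for s r T
    unfolding F_def
    by (rule has_derivative_compose[where f="\<lambda>s. z + s *\<^sub>R h + r *\<^sub>R k" and g=f, OF _ f[OF inU[OF that]]]) (auto intro!: derivative_eq_intros)
  have "\<exists>s\<in>{0<..<1}. (F 1 1 - F 1 0) - (F 0 1 - F 0 0) =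
      A (z + s *\<^sub>R h + 1 *\<^sub>R k) ((1 - 0) *\<^sub>R h) - A (z + s *\<^sub>R h + 0 *\<^sub>R k) ((1 - 0) *\<^sub>R h)"
    by (rule mvt_simple[of 0 1 "\<lambda>s. F s 1 - F s 0"]) (simp, intro has_derivative_diff F, simp_all)
  then obtain s where "s \<in> {0<..<1}" and eq1: "F 1 1 - F 1 0 - (F 0 1 - F 0 0) =
      A (z + s *\<^sub>R h + 1 *\<^sub>R k) ((1 - 0) *\<^sub>R h) - A (z + s *\<^sub>R h + 0 *\<^sub>R k) ((1 - 0) *\<^sub>R h)"
    by blast
  then have s: "0 \<le> s" "s \<le> 1" by auto
  have G: "((\<lambda>r. A (z + s *\<^sub>R h + r *\<^sub>R k) h) has_derivative
      (\<lambda>d. B (z + s *\<^sub>R h + r *\<^sub>R k) h (d *\<^sub>R k))) (at r within T)"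
    if "0 \<le> r" "r \<le> 1" for r T
    by (rule has_derivative_compose[where f="\<lambda>r. z + s *\<^sub>R h + r *\<^sub>R k" and g="\<lambda>x. A x h", OF _ A[OF inU[OF s that]]]) (auto intro!: derivative_eq_intros)
  \<comment> \<open>The parameter \<open>s\<close> is now frozen, and the same direction
    \<open>h\<close> is paired with both values of \<open>A\<close>, so only the base point moves
    along \<open>k\<close>.\<close>
  have "\<exists>r\<in>{0<..<1}. A (z + s *\<^sub>R h + 1 *\<^sub>R k) h - A (z + s *\<^sub>R h + 0 *\<^sub>R k) h
      = B (z + s *\<^sub>R h + r *\<^sub>R k) h ((1 - 0) *\<^sub>R k)"
    by (rule mvt_simple) (simp, intro G, simp_all)
  then obtain r where "r \<in> {0<..<1}" and eq2:
    "A (z + s *\<^sub>R h + 1 *\<^sub>R k) h - A (z + s *\<^sub>R h + 0 *\<^sub>R k) h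
      = B (z + s *\<^sub>R h + r *\<^sub>R k) h ((1 - 0) *\<^sub>R k)"
    by blast
  then have r: "0 \<le> r" "r \<le> 1" by auto
  have "F 1 1 - F 1 0 - F 0 1 + F 0 0 = B (z + s *\<^sub>R h + r *\<^sub>R k) h k"
    using eq1 eq2 by simp
  with small[OF s r] show thesis
    by (intro that) (auto simp: F_def)
qed

text \<open>This is Schwarz's theorem. The second difference with steps \<open>t h\<close> and
  \<open>t k\<close>, divided by \<open>t * t\<close>, tends to \<open>B z h k\<close>; it does not
  change when \<open>h\<close> and \<open>k\<close> are swapped, and limits are unique.\<close>

lemma exact_imp_symmetric_derivative:
  fixes f :: "'a::real_normed_vector \<Rightarrow> real"
  assumes "open U" "z \<in> U"
    and f: "\<And>x. x \<in> U \<Longrightarrow> (f has_derivative A x) (at x)"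
    and A: "\<And>x h. x \<in> U \<Longrightarrow> ((\<lambda>x. A x h) has_derivative B x h) (at x)"
    and cont: "\<And>h k. continuous_on U (\<lambda>x. B x h k)"
  shows "B z h k = B z k h"
proof -
  define N where "N h k = norm h + norm k" for h k :: 'a
  obtain r where r: "r > 0" "cball z r \<subseteq> U"
    using assms(1,2) open_contains_cball by blast
  have key: "((\<lambda>t. (f (z + t *\<^sub>R h + t *\<^sub>R k) - f (z + t *\<^sub>R h) - f (z + t *\<^sub>R k) + f z) / (t * t))
      \<longlongrightarrow> B z h k) (at_right 0)" for h k
  proof (rule tendstoI)
    fix e :: real assume "e > 0"
    have "isCont (\<lambda>x. B x h k) z"
      using cont assms(1,2) by (simp add: continuous_on_eq_continuous_at)
    with \<open>e > 0\<close> obtain d where d: "d > 0" "\<And>x. dist x z < d \<Longrightarrow> dist (B x h k) (B z h k) < e"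
      unfolding continuous_at_eps_delta by (auto simp: dist_real_def dist_norm)
    \<comment> \<open>For \<open>0 < t < c\<close> the scaled parallelogram stays within distance
      \<open>min d r\<close> of \<open>z\<close>: inside \<open>U\<close>, and where
      \<open>B\<close> is within \<open>e\<close> of its value at \<open>z\<close>. The summand 1
      keeps the denominator positive when \<open>h = k = 0\<close>.\<close>
    define c where "c = min d r / (1 + norm h + norm k)"
    have pos: "1 + norm h + norm k > 0"
      by (simp add: add_pos_nonneg)
    have "c > 0"
      using d(1) r(1) pos by (simp add: c_def)
    have "dist ((f (z + t *\<^sub>R h + t *\<^sub>R k) - f (z + t *\<^sub>R h) - f (z + t *\<^sub>R k) + f z) / (t * t)) (B z h k) < e"
      if t: "0 < t" "t < c" for t
    proof -
      have "t * (1 + norm h + norm k) < min d r"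
        using t(2) pos by (simp add: c_def pos_less_divide_eq)
      then have tl: "norm (t *\<^sub>R h) + norm (t *\<^sub>R k) < min d r"
        using t(1) by (simp add: algebra_simps)
      then have sub: "cball z (norm (t *\<^sub>R h) + norm (t *\<^sub>R k)) \<subseteq> U"
        using r(2) subset_cball[of "norm (t *\<^sub>R h) + norm (t *\<^sub>R k)" r z] by simp
      obtain x where x: "dist z x \<le> norm (t *\<^sub>R h) + norm (t *\<^sub>R k)"
        "f (z + t *\<^sub>R h + t *\<^sub>R k) - f (z + t *\<^sub>R h) - f (z + t *\<^sub>R k) + f z = B x (t *\<^sub>R h) (t *\<^sub>R k)"
        by (rule second_difference_mean_value[of U f A B z "t *\<^sub>R h" "t *\<^sub>R k", OF f A sub])
      have "x \<in> U" using x(1) tl r(2) by (auto simp: subset_iff)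
      \<comment> \<open>Homogeneity of \<open>B x\<close> in its first direction is inherited from
        that of \<open>A x\<close>, through uniqueness of the derivative.\<close>
      have "((\<lambda>x. A x (t *\<^sub>R h)) has_derivative (\<lambda>k. t * B x h k)) (at x)"
      proof (rule has_derivative_transform_within_open[OF _ assms(1) \<open>x \<in> U\<close>])
        show "((\<lambda>x. t * A x h) has_derivative (\<lambda>k. t * B x h k)) (at x)"
          by (intro has_derivative_mult_right A \<open>x \<in> U\<close>)
        show "t * A x h = A x (t *\<^sub>R h)" if "x \<in> U" for x
          using has_derivative_linear[OF f[OF that]] by (simp add: linear_scale)
      qed
      then have "B x (t *\<^sub>R h) (t *\<^sub>R k) = t * B x h (t *\<^sub>R k)"
        by (rule has_derivative_unique[OF A[OF \<open>x \<in> U\<close>], THEN fun_cong])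
      also have "\<dots> = t * t * B x h k"
        using has_derivative_linear[OF A[OF \<open>x \<in> U\<close>]] by (simp add: linear_scale)
      finally have "(f (z + t *\<^sub>R h + t *\<^sub>R k) - f (z + t *\<^sub>R h) - f (z + t *\<^sub>R k) + f z) / (t * t) = B x h k"
        using x(2) t(1) by simp
      moreover have "dist x z < d" using x(1) tl by (simp add: dist_commute)
      ultimately show ?thesis using d(2) by simp
    qed
    with \<open>c > 0\<close> show "\<forall>\<^sub>F t in at_right 0. dist ((f (z + t *\<^sub>R h + t *\<^sub>R k) - f (z + t *\<^sub>R h) - f (z + t *\<^sub>R k) + f z) / (t * t)) (B z h k) < e"
      by (auto simp: eventually_at_right_field intro!: exI[of _ c])
  qed
  have "(\<lambda>t. (f (z + t *\<^sub>R k + t *\<^sub>R h) - f (z + t *\<^sub>R k) - f (z + t *\<^sub>R h) + f z) / (t * t))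
    = (\<lambda>t. (f (z + t *\<^sub>R h + t *\<^sub>R k) - f (z + t *\<^sub>R h) - f (z + t *\<^sub>R k) + f z) / (t * t))"
    by (simp add: algebra_simps)
  then have "((\<lambda>t. (f (z + t *\<^sub>R h + t *\<^sub>R k) - f (z + t *\<^sub>R h) - f (z + t *\<^sub>R k) + f z) / (t * t))
      \<longlongrightarrow> B z k h) (at_right 0)"
    using key[of k h] by (simp only:)
  with key[of h k] show ?thesis
    by (rule tendsto_unique[OF trivial_limit_at_right_real])
qed

text \<open>
  By symmetry the \<open>x\<close>-derivative of \<open>A (z + t (x - z)) (x - z)\<close> in direction \<open>k\<close> is the \<open>t\<close>-derivative of
  \<open>t * A (z + t (x - z)) k\<close>, so the primitive is the integral of the former expression over \<open>[0, 1]\<close>.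
\<close>

lemma symmetric_derivative_imp_exact:
  fixes A :: "'a::euclidean_space \<Rightarrow> 'a \<Rightarrow> real"
  assumes "open U" "convex U"
    and lin: "\<And>x. x \<in> U \<Longrightarrow> linear (A x)"
    and A: "\<And>x h. x \<in> U \<Longrightarrow> ((\<lambda>x. A x h) has_derivative B x h) (at x)"
    and cont: "\<And>h k. continuous_on U (\<lambda>x. B x h k)"
    and sym: "\<And>x h k. x \<in> U \<Longrightarrow> B x h k = B x k h"
  obtains f where "\<And>x. x \<in> U \<Longrightarrow> (f has_derivative A x) (at x)"
proof (cases "U = {}")
  case True
  then show ?thesis using that by auto
next
  case False
  then obtain z where z: "z \<in> U" by auto
  \<comment> \<open>The segment from the base point \<open>z\<close> to \<open>x\<close>, along
    which the form is integrated.\<close>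
  define y where "y x t = z + t *\<^sub>R (x - z)" for x and t :: real
  have y: "y x t \<in> U" if "x \<in> U" "t \<in> cbox 0 1" for x t
  proof -
    have "y x t = (1 - t) *\<^sub>R z + t *\<^sub>R x"
      by (simp add: y_def algebra_simps)
    with that z \<open>convex U\<close> show ?thesis
      by (simp add: convex_def)
  qed
  have linB: "linear (B x h)" if "x \<in> U" for x h
    using A[OF that] has_derivative_linear by blast
  \<comment> \<open>Linearity in the second direction comes from \<open>B x h\<close> being a
    derivative; symmetry transfers it to the first.\<close>
  have linBh: "linear (\<lambda>h. B x h k)" if "x \<in> U" for x k
  proof -
    have "(\<lambda>h. B x h k) = B x k"
      by (rule ext) (rule sym[OF that])
    then show ?thesis using linB[OF that] by simp
  qed
  have contA: "continuous_on U (\<lambda>x. A x h)" for h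
    using has_derivative_continuous[OF A] by (auto intro!: continuous_at_imp_continuous_on)
  have conty: "continuous_on T (\<lambda>p. y (a p) (b p))"
    if "continuous_on T a" "continuous_on T b" for T :: "'c::topological_space set" and a b
    unfolding y_def by (intro continuous_intros that)
  have contAy: "continuous_on T (\<lambda>p. A (y (a p) (b p)) h)"
    if "continuous_on T a" "continuous_on T b" "a ` T \<subseteq> U" "b ` T \<subseteq> cbox 0 1"
    for T :: "'c::topological_space set" and a b h
    by (rule continuous_on_compose2[OF contA conty[OF that(1,2)]]) (use that(3,4) y in blast)
  have contBy: "continuous_on T (\<lambda>p. B (y (a p) (b p)) h k)"
    if "continuous_on T a" "continuous_on T b" "a ` T \<subseteq> U" "b ` T \<subseteq> cbox 0 1"
    for T :: "'c::topological_space set" and a b h k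
    by (rule continuous_on_compose2[OF cont conty[OF that(1,2)]]) (use that(3,4) y in blast)
  have A_sum: "A x k = (\<Sum>i\<in>Basis. (k \<bullet> i) * A x i)" if "x \<in> U" for x k
    using linear_sum[OF lin[OF that], of "\<lambda>i. (k \<bullet> i) *\<^sub>R i" Basis]
    by (simp add: linear_scale[OF lin[OF that]] euclidean_representation)
  have B_sum: "B x h k = (\<Sum>i\<in>Basis. (h \<bullet> i) * B x i k)" if "x \<in> U" for x h k
    using linear_sum[OF linBh[OF that], of "\<lambda>i. (h \<bullet> i) *\<^sub>R i" Basis]
    by (simp add: linear_scale[OF linBh[OF that]] euclidean_representation)
  \<comment> \<open>The derivative of the integrand \<open>A (y x t) (x - z)\<close> with respect to
    \<open>x\<close>, in direction \<open>k\<close>. It is packed into a \<open>Blinfun\<close>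
    because \<open>leibniz_rule\<close> works with bounded linear maps as values.\<close>
  define g' where "g' x t k = A (y x t) k + t * B (y x t) (x - z) k" for x t k
  define fx where "fx x t = Blinfun (g' x t)" for x t
  have bl: "bounded_linear (g' x t)" if "x \<in> U" "t \<in> cbox 0 1" for x t
  proof -
    have "linear (g' x t)"
      using lin[OF y[OF that]] linB[OF y[OF that]]
      by (intro linearI) (simp_all add: g'_def linear_add linear_scale algebra_simps)
    then show ?thesis by (simp add: linear_conv_bounded_linear)
  qed
  have fx: "blinfun_apply (fx x t) = g' x t" if "x \<in> U" "t \<in> cbox 0 1" for x t
    unfolding fx_def using bl[OF that] by (simp add: bounded_linear_Blinfun_apply)
  define f where "f x = integral (cbox 0 1) (\<lambda>t. A (y x t) (x - z))" for x
  have "(f has_derivative A x) (at x)" if x: "x \<in> U" for x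
  proof -
    have "(f has_derivative blinfun_apply (integral (cbox 0 1) (fx x))) (at x within U)"
      unfolding f_def
    proof (rule leibniz_rule[OF _ _ _ x \<open>convex U\<close>])
      fix x and t :: real assume xt: "x \<in> U" "t \<in> cbox 0 1"
      have 1: "((\<lambda>x. A (y x t) i) has_derivative (\<lambda>k. t * B (y x t) i k)) (at x within U)" for i
      proof -
        have "((\<lambda>x. A (y x t) i) has_derivative (\<lambda>k. B (y x t) i (t *\<^sub>R k))) (at x within U)"
          by (rule has_derivative_compose[where f="\<lambda>x. y x t" and g="\<lambda>x. A x i", OF _ A[OF y[OF xt]]])
             (auto simp: y_def intro!: derivative_eq_intros)
        then show ?thesis by (simp add: linear_scale[OF linB[OF y[OF xt]]])
      qed
      have 2: "((\<lambda>x. (x - z) \<bullet> i) has_derivative (\<lambda>k. k \<bullet> i)) (at x within U)" for i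
        by (auto intro!: derivative_eq_intros)
      \<comment> \<open>Both the base point and the direction of \<open>A (y x t) (x - z)\<close>
        depend on \<open>x\<close>; in coordinates this becomes a sum of ordinary products.\<close>
      have "((\<lambda>x. \<Sum>i\<in>Basis. ((x - z) \<bullet> i) * A (y x t) i) has_derivative
          (\<lambda>k. \<Sum>i\<in>Basis. ((x - z) \<bullet> i) * (t * B (y x t) i k) + (k \<bullet> i) * A (y x t) i)) (at x within U)"
        by (intro has_derivative_sum has_derivative_mult 1 2)
      moreover have "(\<lambda>k. \<Sum>i\<in>Basis. ((x - z) \<bullet> i) * (t * B (y x t) i k) + (k \<bullet> i) * A (y x t) i) = g' x t"
      proof
        fix k
        show "(\<Sum>i\<in>Basis. ((x - z) \<bullet> i) * (t * B (y x t) i k) + (k \<bullet> i) * A (y x t) i) = g' x t k"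
          unfolding g'_def A_sum[OF y[OF xt], of k] B_sum[OF y[OF xt], of "x - z" k]
          by (simp add: sum.distrib sum_distrib_left mult.left_commute add.commute)
      qed
      ultimately have "((\<lambda>x. \<Sum>i\<in>Basis. ((x - z) \<bullet> i) * A (y x t) i) has_derivative g' x t) (at x within U)"
        by simp
      then have "((\<lambda>x. A (y x t) (x - z)) has_derivative g' x t) (at x within U)"
        by (rule has_derivative_transform[OF xt(1) A_sum[OF y[OF _ xt(2)]], rotated])
      then show "((\<lambda>x. A (y x t) (x - z)) has_derivative blinfun_apply (fx x t)) (at x within U)"
        by (simp add: fx[OF xt])
    next
      fix x assume "x \<in> U"
      have "continuous_on (cbox 0 1) (\<lambda>t. \<Sum>i\<in>Basis. ((x - z) \<bullet> i) * A (y x t) i)"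
        using \<open>x \<in> U\<close> by (intro continuous_intros contAy) auto
      then have "continuous_on (cbox 0 1) (\<lambda>t. A (y x t) (x - z))"
        by (rule continuous_on_eq) (rule A_sum[OF y[OF \<open>x \<in> U\<close>], symmetric])
      then show "(\<lambda>t. A (y x t) (x - z)) integrable_on cbox 0 1"
        by (rule integrable_continuous)
    next
      have "continuous_on (U \<times> cbox 0 1) (\<lambda>p. fx (fst p) (snd p))"
      proof (rule continuous_on_blinfun_componentwise)
        fix k :: 'a assume "k \<in> Basis"
        have "continuous_on (U \<times> cbox 0 1) (\<lambda>p. A (y (fst p) (snd p)) k
            + snd p * (\<Sum>i\<in>Basis. ((fst p - z) \<bullet> i) * B (y (fst p) (snd p)) i k))"
          by (intro continuous_intros contAy contBy) auto
        then show "continuous_on (U \<times> cbox 0 1) (\<lambda>p. blinfun_apply (fx (fst p) (snd p)) k)"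
        proof (rule continuous_on_eq)
          fix p :: "'a \<times> real" assume "p \<in> U \<times> cbox 0 1"
          then have "fst p \<in> U" "snd p \<in> cbox 0 1" by auto
          then show "A (y (fst p) (snd p)) k + snd p * (\<Sum>i\<in>Basis. ((fst p - z) \<bullet> i) * B (y (fst p) (snd p)) i k)
            = blinfun_apply (fx (fst p) (snd p)) k"
            by (simp only: fx g'_def B_sum[OF y, of "fst p" "snd p" "fst p - z" k])
        qed
      qed
      then show "continuous_on (U \<times> cbox 0 1) (\<lambda>(x, t). fx x t)"
        by (simp add: case_prod_beta)
    qed
    moreover have "blinfun_apply (integral (cbox 0 1) (fx x)) k = A x k" for k
    proof -
      have "fx x integrable_on cbox 0 1"
      proof (rule integrable_continuous, rule continuous_on_blinfun_componentwise)
        fix k :: 'a assume "k \<in> Basis"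
        have "continuous_on (cbox 0 1) (\<lambda>t. A (y x t) k + t * B (y x t) (x - z) k)"
          using x by (intro continuous_intros contAy contBy) auto
        then show "continuous_on (cbox 0 1) (\<lambda>t. blinfun_apply (fx x t) k)"
          by (rule continuous_on_eq) (simp only: fx[OF x] g'_def)
      qed
      then have "blinfun_apply (integral (cbox 0 1) (fx x)) k = integral (cbox 0 1) (\<lambda>t. blinfun_apply (fx x t) k)"
        by (rule blinfun_apply_integral)
      \<comment> \<open>The antiderivative in \<open>t\<close> is \<open>t * A (y x t) k\<close>,
        which is \<open>A x k\<close> at 1 and vanishes at 0.\<close>
      moreover have "((\<lambda>t. blinfun_apply (fx x t) k) has_integral (1 * A (y x 1) k - 0 * A (y x 0) k)) {0..1}"
      proof (rule fundamental_theorem_of_calculus)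
        fix t :: real assume t: "t \<in> {0..1}"
        then have t': "t \<in> cbox 0 1" by simp
        have "((\<lambda>t. y x t) has_derivative (\<lambda>d. d *\<^sub>R (x - z))) (at t within {0..1})"
          unfolding y_def by (auto intro!: derivative_eq_intros)
        then have "((\<lambda>t. A (y x t) k) has_derivative (\<lambda>d. B (y x t) k (d *\<^sub>R (x - z)))) (at t within {0..1})"
          by (rule has_derivative_compose[where f="y x" and g="\<lambda>x. A x k", OF _ A[OF y[OF x t']]])
        \<comment> \<open>Closedness of the form enters here: swapping the directions turns the
          derivative along the segment into the term appearing in \<open>g'\<close>.\<close>
        moreover have "B (y x t) k (d *\<^sub>R (x - z)) = d *\<^sub>R B (y x t) (x - z) k" for d
          by (subst sym[OF y[OF x t']]) (rule linear_scale[OF linBh[OF y[OF x t']]])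
        ultimately have "((\<lambda>t. A (y x t) k) has_vector_derivative B (y x t) (x - z) k) (at t within {0..1})"
          by (simp add: has_vector_derivative_def)
        then have "((\<lambda>t. t * A (y x t) k) has_vector_derivative t * B (y x t) (x - z) k + 1 * A (y x t) k) (at t within {0..1})"
          by (rule has_vector_derivative_mult[OF has_vector_derivative_id])
        then show "((\<lambda>t. t * A (y x t) k) has_vector_derivative blinfun_apply (fx x t) k) (at t within {0..1})"
          by (simp add: fx[OF x t'] g'_def add.commute)
      qed simp
      then have "integral (cbox 0 1) (\<lambda>t. blinfun_apply (fx x t) k) = A x k"
        by (simp add: y_def integral_unique)
      ultimately show ?thesis by simp
    qed
    then have "blinfun_apply (integral (cbox 0 1) (fx x)) = A x" ..
    ultimately have "(f has_derivative A x) (at x within U)"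
      by simp
    then show ?thesis
      by (simp only: at_within_open[OF x \<open>open U\<close>])
  qed
  then show ?thesis by (rule that)
qed

text \<open>Schwarz's theorem for vector values, obtained by testing against each basis vector
  \<open>b\<close>: the component \<open>f x \<bullet> b\<close> is a primitive of the corresponding
  component of the derivative.\<close>

lemma smooth_on_second_derivative_symmetric:
  fixes f :: "'a::euclidean_space \<Rightarrow> 'b::euclidean_space"
  assumes "open X" "smooth_on X f" "x \<in> X"
  shows "frechet_derivative (\<lambda>x. frechet_derivative f (at x) h) (at x) k =
    frechet_derivative (\<lambda>x. frechet_derivative f (at x) k) (at x) h"
proof (rule euclidean_eqI)
  fix b :: 'b
  show "frechet_derivative (\<lambda>x. frechet_derivative f (at x) h) (at x) k \<bullet> b =
    frechet_derivative (\<lambda>x. frechet_derivative f (at x) k) (at x) h \<bullet> b"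
  proof (rule exact_imp_symmetric_derivative[OF assms(1,3), where f="\<lambda>x. f x \<bullet> b"
        and A="\<lambda>x h. frechet_derivative f (at x) h \<bullet> b"
        and B="\<lambda>x h k. frechet_derivative (\<lambda>x. frechet_derivative f (at x) h) (at x) k \<bullet> b"])
    fix x assume "x \<in> X"
    then show "((\<lambda>x. f x \<bullet> b) has_derivative (\<lambda>h. frechet_derivative f (at x) h \<bullet> b)) (at x)"
      by (intro has_derivative_inner_left smooth_on_has_derivative[OF assms(2)])
    fix h
    from \<open>x \<in> X\<close> show "((\<lambda>x. frechet_derivative f (at x) h \<bullet> b) has_derivative
        (\<lambda>k. frechet_derivative (\<lambda>x. frechet_derivative f (at x) h) (at x) k \<bullet> b)) (at x)"
      by (intro has_derivative_inner_left smooth_on_has_derivative[OF smooth_on_frechet[OF assms(2)]])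
  next
    fix h k
    show "continuous_on X (\<lambda>x. frechet_derivative (\<lambda>x. frechet_derivative f (at x) h) (at x) k \<bullet> b)"
      using smooth_on_continuous[OF smooth_on_frechet[OF smooth_on_frechet[OF assms(2)]]]
      by (intro continuous_intros)
  qed
qed

subsection \<open>Inverses of smooth maps\<close>

text \<open>Where \<open>r\<close> vanishes, \<open>r y\<close> is of order \<open>y - x\<close>
  while \<open>c y - c x\<close> tends to 0, so their product contributes nothing to first order.
  This permits differentiating an inverse while only its continuity is known.\<close>

lemma has_derivative_scaleR_vanishing:
  fixes c :: "'a::real_normed_vector \<Rightarrow> 'b::real_normed_vector"
  assumes r: "(r has_derivative r') (at x)" "r x = 0" and c: "isCont c x"
  shows "((\<lambda>y. r y *\<^sub>R c y) has_derivative (\<lambda>k. r' k *\<^sub>R c x)) (at x)"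
proof -
  have bl: "bounded_linear r'"
    using r(1) has_derivative_bounded_linear by blast
  obtain K where K: "K > 0" "\<And>k. norm (r' k) \<le> norm k * K"
    using bounded_linear.pos_bounded[OF bl] by blast
  have "((\<lambda>y. r y *\<^sub>R (c y - c x)) has_derivative (\<lambda>_. 0)) (at x)"
    unfolding has_derivative_within_alt2
  proof (intro conjI allI impI)
    fix e :: real assume "e > 0"
    \<comment> \<open>Near \<open>x\<close> the norm of \<open>r y\<close> is at most
      \<open>(1 + K) * norm (y - x)\<close>, so this \<open>d\<close> makes the product at most
      \<open>e * norm (y - x)\<close>.\<close>
    define d where "d = e / (1 + K)"
    have "d > 0" using \<open>e > 0\<close> K(1) by (simp add: d_def)
    have "\<forall>\<^sub>F y in at x. norm (r y - r x - r' (y - x)) \<le> 1 * norm (y - x)"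
      using r(1) zero_less_one unfolding has_derivative_within_alt2 by blast
    moreover have "\<forall>\<^sub>F y in at x. dist (c y) (c x) < d"
      using c \<open>d > 0\<close> by (simp add: isCont_def tendsto_iff)
    ultimately show "\<forall>\<^sub>F y in at x. norm (r y *\<^sub>R (c y - c x) - r x *\<^sub>R (c x - c x) - 0) \<le> e * norm (y - x)"
    proof eventually_elim
      case (elim y)
      have "norm (r y) \<le> norm (r y - r x - r' (y - x)) + norm (r' (y - x))"
        using norm_triangle_ineq[of "r y - r x - r' (y - x)" "r' (y - x)"] r(2) by simp
      also have "\<dots> \<le> norm (y - x) * (1 + K)"
        using elim(1) K(2)[of "y - x"] by (simp add: algebra_simps)
      finally have "norm (r y) * norm (c y - c x) \<le> (norm (y - x) * (1 + K)) * d"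
        using elim(2) K(1) by (intro mult_mono) (auto simp: dist_norm)
      also have "\<dots> = e * norm (y - x)"
        using K(1) by (simp add: d_def)
      finally show ?case using r(2) by simp
    qed
  qed simp
  moreover have "((\<lambda>y. r y *\<^sub>R c x) has_derivative (\<lambda>k. r' k *\<^sub>R c x)) (at x)"
    by (intro has_derivative_scaleR_left r)
  ultimately have "((\<lambda>y. r y *\<^sub>R (c y - c x) + r y *\<^sub>R c x) has_derivative (\<lambda>k. 0 + r' k *\<^sub>R c x)) (at x)"
    by (rule has_derivative_add)
  then show ?thesis by (simp add: scaleR_diff_right)
qed

text \<open>The lower bound forces a trivial kernel, equality of dimensions gives surjectivity, and
  the same bound at \<open>inv L h\<close> controls the inverse.\<close>

lemma linear_bounded_below_inverse:
  fixes L :: "'b::euclidean_space \<Rightarrow> 'b"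
  assumes "linear L" "c > 0" "\<And>h. c * norm h \<le> norm (L h)"
  shows "linear (inv L)" "L (inv L h) = h" "inv L (L h) = h" "norm (inv L h) \<le> norm h / c"
proof -
  have "inj L"
  proof (subst linear_injective_0[OF assms(1)], intro allI impI)
    fix h assume "L h = 0"
    then have "c * norm h \<le> 0" using assms(3)[of h] by simp
    then show "h = 0" using \<open>c > 0\<close> by (simp add: mult_le_0_iff)
  qed
  then show "linear (inv L)" "inv L (L h) = h"
    using inj_linear_imp_inv_linear[OF assms(1)] by auto
  have "surj L"
    using linear_injective_imp_surjective[OF assms(1) \<open>inj L\<close>] by simp
  then show L: "L (inv L h) = h"
    by (simp add: surj_f_inv_f)
  show "norm (inv L h) \<le> norm h / c"
    using assms(3)[of "inv L h"] \<open>c > 0\<close> by (simp add: L pos_le_divide_eq mult.commute)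
qed

text \<open>The resolvent identity yields first continuity and then the derivative
  \<open>- A M A\<close> of the inverse \<open>A\<close>. That formula involves only
  \<open>A\<close> and derivatives of \<open>L\<close>, so the order of \<open>A\<close> can be
  raised one step at a time.\<close>

lemma smooth_on_inv_linear_family:
  fixes L :: "'a::euclidean_space \<Rightarrow> 'b::euclidean_space \<Rightarrow> 'b"
  assumes "open X" and lin: "\<And>x. x \<in> X \<Longrightarrow> linear (L x)"
    and "c > 0" and below: "\<And>x h. x \<in> X \<Longrightarrow> c * norm h \<le> norm (L x h)"
    and smooth: "\<And>h. smooth_on X (\<lambda>x. L x h)"
  shows "smooth_on X (\<lambda>x. inv (L x) h)"
proof -
  define A where "A x = inv (L x)" for x
  note inv = linear_bounded_below_inverse[OF lin \<open>c > 0\<close> below]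
  have linA: "linear (A x)" if "x \<in> X" for x
    unfolding A_def using inv(1) that by blast
  have LA: "L x (A x h) = h" and AL: "A x (L x h) = h" and nA: "norm (A x h) \<le> norm h / c"
    if "x \<in> X" for x h
    unfolding A_def using inv(2-4) that by blast+
  have resolvent: "A y h = A x h - A y (L y (A x h) - L x (A x h))" if "x \<in> X" "y \<in> X" for x y h
    using that by (simp add: linear_diff[OF linA] LA AL)
  \<comment> \<open>The derivative of \<open>L\<close> in direction \<open>k\<close> at
    \<open>x\<close>, applied to \<open>a\<close>. The basis expansion makes its smoothness
    available also when \<open>a\<close> varies with \<open>x\<close>.\<close>
  define M where "M k x a = (\<Sum>b\<in>Basis. (a \<bullet> b) *\<^sub>R frechet_derivative (\<lambda>z. L z b) (at x) k)" for k x a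
  have L_sum: "L x a = (\<Sum>b\<in>Basis. (a \<bullet> b) *\<^sub>R L x b)" if "x \<in> X" for x a
    using linear_sum[OF lin[OF that], of "\<lambda>b. (a \<bullet> b) *\<^sub>R b" Basis]
    by (simp add: linear_scale[OF lin[OF that]] euclidean_representation)
  have A_sum: "A x a = (\<Sum>b\<in>Basis. (a \<bullet> b) *\<^sub>R A x b)" if "x \<in> X" for x a
    using linear_sum[OF linA[OF that], of "\<lambda>b. (a \<bullet> b) *\<^sub>R b" Basis]
    by (simp add: linear_scale[OF linA[OF that]] euclidean_representation)
  have M: "((\<lambda>z. L z a) has_derivative (\<lambda>k. M k x a)) (at x)" if "x \<in> X" for x a
  proof (rule has_derivative_transform_within_open[OF _ \<open>open X\<close> that])
    show "((\<lambda>z. \<Sum>b\<in>Basis. (a \<bullet> b) *\<^sub>R L z b) has_derivative (\<lambda>k. M k x a)) (at x)"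
      unfolding M_def
      by (intro has_derivative_sum has_derivative_scaleR_right smooth_on_has_derivative[OF smooth that])
  qed (rule L_sum[symmetric])
  have contA: "isCont (\<lambda>y. A y h) x" if x: "x \<in> X" for x h
  proof -
    have "isCont (\<lambda>y. L y (A x h)) x"
      using M[OF x] has_derivative_continuous by blast
    then have "((\<lambda>y. norm (L y (A x h) - L x (A x h)) / c) \<longlongrightarrow> norm (L x (A x h) - L x (A x h)) / c) (at x)"
      unfolding isCont_def by (intro tendsto_intros) (use \<open>c > 0\<close> in auto)
    then have "((\<lambda>y. norm (L y (A x h) - L x (A x h)) / c) \<longlongrightarrow> 0) (at x)" by simp
    \<comment> \<open>The bound \<open>1 / c\<close> on the inverses is uniform in \<open>y\<close>,
      so continuity of \<open>L\<close> at the fixed vector \<open>A x h\<close> suffices.\<close>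
    moreover have "\<forall>\<^sub>F y in at x. norm (A y h - A x h) \<le> norm (L y (A x h) - L x (A x h)) / c"
      using eventually_at_in_open'[OF \<open>open X\<close> x]
    proof eventually_elim
      case (elim y)
      have "norm (A y h - A x h) = norm (A y (L y (A x h) - L x (A x h)))"
        using resolvent[OF x elim, of h] by simp
      then show ?case using nA[OF elim] by simp
    qed
    ultimately have "((\<lambda>y. A y h - A x h) \<longlongrightarrow> 0) (at x)"
      by (rule Lim_null_comparison[rotated])
    then show ?thesis by (simp add: isCont_def LIM_zero_iff)
  qed
  have derA: "((\<lambda>y. A y h) has_derivative (\<lambda>k. - A x (M k x (A x h)))) (at x)" if x: "x \<in> X" for x h
  proof (rule has_derivative_transform_within_open[OF _ \<open>open X\<close> x])
    define m where "m y = L y (A x h) - L x (A x h)" for y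
    have dm: "(m has_derivative (\<lambda>k. M k x (A x h))) (at x)"
      unfolding m_def using has_derivative_diff[OF M[OF x] has_derivative_const] by simp
    \<comment> \<open>In the resolvent identity the unknown \<open>A y b\<close> is multiplied by a
      coefficient of \<open>m y\<close>, which vanishes at \<open>x\<close>.\<close>
    have "((\<lambda>y. (m y \<bullet> b) *\<^sub>R A y b) has_derivative (\<lambda>k. (M k x (A x h) \<bullet> b) *\<^sub>R A x b)) (at x)" for b
      by (rule has_derivative_scaleR_vanishing[OF has_derivative_inner_left[OF dm] _ contA[OF x]])
         (simp add: m_def)
    then have "((\<lambda>y. A x h - (\<Sum>b\<in>Basis. (m y \<bullet> b) *\<^sub>R A y b)) has_derivative
        (\<lambda>k. 0 - (\<Sum>b\<in>Basis. (M k x (A x h) \<bullet> b) *\<^sub>R A x b))) (at x)"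
      by (intro has_derivative_diff has_derivative_const has_derivative_sum)
    moreover have "(\<Sum>b\<in>Basis. (M k x (A x h) \<bullet> b) *\<^sub>R A x b) = A x (M k x (A x h))" for k
      by (rule A_sum[OF x, symmetric])
    ultimately show "((\<lambda>y. A x h - (\<Sum>b\<in>Basis. (m y \<bullet> b) *\<^sub>R A y b)) has_derivative
        (\<lambda>k. - A x (M k x (A x h)))) (at x)"
      by simp
    show "A x h - (\<Sum>b\<in>Basis. (m y \<bullet> b) *\<^sub>R A y b) = A y h" if "y \<in> X" for y
      using resolvent[OF x that, of h] A_sum[OF that, of "m y"] by (simp only: m_def)
  qed
  have "ck_on n X (\<lambda>x. A x h)" for n h
  proof (induction n arbitrary: h)
    case 0
    then show ?case by (auto intro!: continuous_at_imp_continuous_on contA)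
  next
    case (Suc n)
    have "ck_on n X (\<lambda>x. (A x h \<bullet> b) *\<^sub>R frechet_derivative (\<lambda>z. L z b) (at x) k)" for b k
    proof (rule ck_on_bilinear[OF \<open>open X\<close> bounded_bilinear_scaleR])
      show "ck_on n X (\<lambda>x. A x h \<bullet> b)"
        by (rule ck_on_bounded_linear[OF \<open>open X\<close> bounded_linear_inner_left Suc.IH])
      show "ck_on n X (\<lambda>x. frechet_derivative (\<lambda>z. L z b) (at x) k)"
        using smooth_on_frechet[OF smooth] by (simp add: smooth_on_def)
    qed
    then have ckM: "ck_on n X (\<lambda>x. M k x (A x h))" for k
      unfolding M_def by (rule ck_on_sum[OF \<open>open X\<close>])
    have "ck_on n X (\<lambda>x. A x (M k x (A x h)))" for k
      by (rule ck_on_linear_family[OF \<open>open X\<close> linA Suc.IH ckM])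
    then have "ck_on n X (\<lambda>x. - A x (M k x (A x h)))" for k
      by (rule ck_on_bounded_linear[OF \<open>open X\<close> bounded_linear_minus[OF bounded_linear_ident]])
    then show ?case
      by (rule ck_on_SucI[OF \<open>open X\<close> derA, rotated])
  qed
  then show ?thesis by (simp add: smooth_on_def A_def)
qed

text \<open>
  Quantifying over all smooth \<open>F\<close> makes the induction on the order close up: the derivative of
  \<open>F \<circ> g\<^sup>-\<^sup>1\<close> is again of the form \<open>F\<^sub>1 \<circ> g\<^sup>-\<^sup>1\<close> with \<open>F\<^sub>1\<close> smooth.
\<close>

lemma smooth_on_compose_inv_into:
  fixes g :: "'a::euclidean_space \<Rightarrow> 'a" and F :: "'a \<Rightarrow> 'b::real_normed_vector"
  assumes "open X" "inj_on g X" and g: "smooth_on X g"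
    and "c > 0" and below: "\<And>x h. x \<in> X \<Longrightarrow> c * norm h \<le> norm (frechet_derivative g (at x) h)"
    and "smooth_on X F"
  shows "smooth_on (g ` X) (\<lambda>y. F (inv_into X g y))"
proof -
  define G where "G = inv_into X g"
  define A where "A x = inv (frechet_derivative g (at x))" for x
  have contg: "continuous_on X g"
    using g by (rule smooth_on_continuous)
  have open_im: "open (g ` X)"
    using contg assms(1,2) by (rule invariance_of_domain)
  have contG: "continuous_on (g ` X) G"
    unfolding G_def using contg assms(1,2) by (intro continuous_on_inverse_open) auto
  have dg: "(g has_derivative frechet_derivative g (at x)) (at x)" if "x \<in> X" for x
    using g that by (rule smooth_on_has_derivative)
  note lin = has_derivative_linear[OF dg]
  note inv = linear_bounded_below_inverse[OF lin \<open>c > 0\<close> below]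
  have linA: "linear (A x)" if "x \<in> X" for x
    unfolding A_def using inv(1) that by blast
  have smoothA: "smooth_on X (\<lambda>x. A x h)" for h
    unfolding A_def
    by (rule smooth_on_inv_linear_family[OF \<open>open X\<close> lin \<open>c > 0\<close> below smooth_on_frechet[OF g]])
  have GX: "G y \<in> X" "g (G y) = y" if "y \<in> g ` X" for y
    using that by (auto simp: G_def inv_into_into f_inv_into_f)
  have dG: "(G has_derivative A (G y)) (at y)" if y: "y \<in> g ` X" for y
  proof (rule has_derivative_inverse_basic[OF dg[OF GX(1)[OF y]] _ _ _ open_im y GX(2)])
    show "bounded_linear (A (G y))"
      using linA[OF GX(1)[OF y]] by (simp add: linear_conv_bounded_linear)
    show "A (G y) \<circ> frechet_derivative g (at (G y)) = id"
      using inv(3) GX(1)[OF y] by (auto simp: A_def)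
    show "isCont G y"
      by (rule bspec[OF iffD1[OF continuous_on_eq_continuous_at[OF open_im] contG] y])
  qed
  have "ck_on n (g ` X) (\<lambda>y. F (G y))" if "smooth_on X F" for n and F :: "'a \<Rightarrow> 'b"
    using that
  proof (induction n arbitrary: F)
    case 0
    then show ?case
      using continuous_on_compose2[OF smooth_on_continuous contG] GX by auto
  next
    case (Suc n)
    show ?case
    proof (rule ck_on_SucI[OF open_im])
      show "((\<lambda>y. F (G y)) has_derivative (\<lambda>h. frechet_derivative F (at (G y)) (A (G y) h))) (at y)"
        if "y \<in> g ` X" for y
        by (rule has_derivative_compose[OF dG[OF that] smooth_on_has_derivative[OF Suc.prems GX(1)[OF that]]])
      fix h
      \<comment> \<open>This is the new function to which the induction hypothesis is applied; it
        has to be smooth to every order \<open>m\<close>, not merely to order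
        \<open>n\<close>.\<close>
      have "smooth_on X (\<lambda>x. frechet_derivative F (at x) (A x h))"
        unfolding smooth_on_def
      proof
        fix m
        show "ck_on m X (\<lambda>x. frechet_derivative F (at x) (A x h))"
        proof (rule ck_on_linear_family[OF \<open>open X\<close>])
          show "linear (frechet_derivative F (at x))" if "x \<in> X" for x
            by (rule has_derivative_linear[OF smooth_on_has_derivative[OF Suc.prems that]])
        qed (use smoothA smooth_on_frechet[OF Suc.prems] in \<open>simp_all add: smooth_on_def\<close>)
      qed
      then show "ck_on n (g ` X) (\<lambda>y. frechet_derivative F (at (G y)) (A (G y) h))"
        by (rule Suc.IH)
    qed
  qed
  with \<open>smooth_on X F\<close> show ?thesis by (simp add: smooth_on_def G_def)
qed

text \<open>On a convex set \<open>g\<close> minus the identity is Lipschitz with constant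
  \<open>c < 1\<close>, so two points with the same image are at distance 0.\<close>

lemma near_identity_injective:
  fixes g :: "'a::euclidean_space \<Rightarrow> 'a"
  assumes "convex X" "c < 1"
    and g: "\<And>x. x \<in> X \<Longrightarrow> (g has_derivative g' x) (at x)"
    and near: "\<And>x h. x \<in> X \<Longrightarrow> norm (g' x h - h) \<le> c * norm h"
  shows "inj_on g X"
proof (rule inj_onI)
  fix x y assume xy: "x \<in> X" "y \<in> X" "g x = g y"
  have "norm ((g x - x) - (g y - y)) \<le> c * norm (x - y)"
  proof (rule differentiable_bound[OF \<open>convex X\<close> _ _ xy(1,2)])
    show "((\<lambda>x. g x - x) has_derivative (\<lambda>h. g' x h - h)) (at x within X)" if "x \<in> X" for x
      by (intro has_derivative_diff has_derivative_at_withinI[OF g[OF that]] has_derivative_ident)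
    show "onorm (\<lambda>h. g' x h - h) \<le> c" if "x \<in> X" for x
      by (rule onorm_le) (simp add: near[OF that] mult.commute)
  qed
  moreover have "norm ((g x - x) - (g y - y)) = norm (x - y)"
    using xy(3) by (simp add: norm_minus_commute)
  ultimately have "(1 - c) * norm (x - y) \<le> 0"
    by (simp add: left_diff_distrib)
  then show "x = y"
    using \<open>c < 1\<close> by (simp add: mult_le_0_iff)
qed

subsection \<open>The symplectic form\<close>

text \<open>The standard symplectic form, \<open>a\<^sup>T J b\<close> for the corresponding column
  vectors.\<close>

definition omega :: "'d::finite phase \<Rightarrow> 'd phase \<Rightarrow> real" where
  "omega a b = fst a \<bullet> snd b - snd a \<bullet> fst b"

lemma bounded_bilinear_omega: "bounded_bilinear (omega :: 'd::finite phase \<Rightarrow> 'd phase \<Rightarrow> real)"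
proof -
  have 1: "bounded_bilinear (\<lambda>(a :: 'd phase) (b :: 'd phase). fst a \<bullet> snd b)"
    by (rule bounded_bilinear.comp[OF bounded_bilinear_inner bounded_linear_fst bounded_linear_snd])
  have 2: "bounded_bilinear (\<lambda>(a :: 'd phase) (b :: 'd phase). snd a \<bullet> fst b)"
    by (rule bounded_bilinear.comp[OF bounded_bilinear_inner bounded_linear_snd bounded_linear_fst])
  obtain K where K: "\<And>(a :: 'd phase) (b :: 'd phase). norm (fst a \<bullet> snd b) \<le> norm a * norm b * K"
    using bounded_bilinear.bounded[OF 1] by blast
  obtain K' where K': "\<And>(a :: 'd phase) (b :: 'd phase). norm (snd a \<bullet> fst b) \<le> norm a * norm b * K'"
    using bounded_bilinear.bounded[OF 2] by blast
  show ?thesis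
  proof
    fix a b c :: "'d::finite phase" and r
    show "omega (a + b) c = omega a c + omega b c" "omega a (b + c) = omega a b + omega a c"
      "omega (r *\<^sub>R a) b = r *\<^sub>R omega a b" "omega a (r *\<^sub>R b) = r *\<^sub>R omega a b"
      by (simp_all add: omega_def algebra_simps)
    have "norm (omega a b) \<le> norm a * norm b * (K + K')" for a b :: "'d::finite phase"
      using norm_triangle_ineq4[of "fst a \<bullet> snd b" "snd a \<bullet> fst b"] K[of a b] K'[of a b]
      by (simp add: omega_def ring_distribs)
    then show "\<exists>K. \<forall>(a :: 'd phase) (b :: 'd phase). norm (omega a b) \<le> norm a * norm b * K" by blast
  qed
qed

section \<open>Column vectors and the matrix form of symplecticity\<close>

lemma stack_unstack [simp]: "stack (unstack w) = w"
  by (simp add: vec_eq_iff stack_def unstack_def split: sum.split)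

lemma unstack_stack [simp]: "unstack (stack z) = z"
  by (simp add: prod_eq_iff vec_eq_iff stack_def unstack_def)

lemma sum_UNIV_Plus: "(\<Sum>k\<in>UNIV. f k) = (\<Sum>i\<in>UNIV. f (Inl i)) + (\<Sum>i\<in>UNIV. f (Inr i))"
  for f :: "'a::finite + 'b::finite \<Rightarrow> 'c::comm_monoid_add"
  by (simp add: UNIV_Plus_UNIV[symmetric] sum.Plus del: UNIV_Plus_UNIV)

lemma inner_stack: "stack a \<bullet> stack b = a \<bullet> b"
  by (simp add: inner_vec_def sum_UNIV_Plus stack_def inner_prod_def)

lemma norm_stack: "norm (stack a) = norm a"
  by (simp add: norm_eq_sqrt_inner inner_stack)

lemma linear_stack: "linear stack"
  by (rule linearI) (simp_all add: vec_eq_iff stack_def split: sum.split)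

lemma linear_unstack: "linear unstack"
  by (rule linearI) (simp_all add: prod_eq_iff vec_eq_iff unstack_def)

text \<open>The chain rule for conjugation by the mutually inverse linear maps \<open>stack\<close>
  and \<open>unstack\<close>. It translates statements about the Jacobian matrix into statements
  about the derivative.\<close>

lemma phase_jacobian_stack:
  assumes "(\<phi> has_derivative \<phi>') (at z)"
  shows "phase_jacobian \<phi> z *v stack h = stack (\<phi>' h)"
proof -
  have "(unstack has_derivative unstack) (at (stack z))"
    using linear_unstack by (intro bounded_linear_imp_has_derivative) (simp add: linear_conv_bounded_linear)
  then have "((\<lambda>w. \<phi> (unstack w)) has_derivative (\<lambda>h. \<phi>' (unstack h))) (at (stack z))"
    by (rule has_derivative_compose) (simp add: assms)
  then have "((\<lambda>w. stack (\<phi> (unstack w))) has_derivative (\<lambda>h. stack (\<phi>' (unstack h)))) (at (stack z))"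
    by (rule bounded_linear.has_derivative[OF linear_stack[unfolded linear_conv_bounded_linear]])
  then have der: "(stack \<circ> \<phi> \<circ> unstack has_derivative (\<lambda>h. stack (\<phi>' (unstack h)))) (at (stack z))"
    by (simp add: o_def)
  then have "(\<lambda>h. phase_jacobian \<phi> z *v h) = (\<lambda>h. stack (\<phi>' (unstack h)))"
    unfolding phase_jacobian_def
    by (intro has_derivative_unique[OF jacobian_works[THEN iffD1] der]) (auto simp: differentiable_def)
  from fun_cong[OF this, of "stack h"] show ?thesis by simp
qed

lemma stack_inner_J_matrix: "stack a \<bullet> (J_matrix *v stack b) = omega a b"
proof -
  have "J_matrix *v stack b = stack (snd b, - fst b)"
    by (auto simp: vec_eq_iff matrix_vector_mult_def J_matrix_def sum_UNIV_Plus stack_def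
        if_distrib[of "\<lambda>c. c * _"] sum.delta' cong: if_cong split: sum.split)
  then show ?thesis by (simp add: inner_stack omega_def inner_prod_def)
qed

text \<open>A matrix is determined by its bilinear form, and every column vector is the
  \<open>stack\<close> of some phase point; the form of the left-hand matrix is the pullback of
  \<open>omega\<close>.\<close>

lemma symplectic_iff_omega:
  assumes "(\<phi> has_derivative \<phi>') (at z)"
  shows "transpose (phase_jacobian \<phi> z) ** J_matrix ** phase_jacobian \<phi> z = J_matrix \<longleftrightarrow>
    (\<forall>h k. omega (\<phi>' h) (\<phi>' k) = omega h k)" (is "?M = _ \<longleftrightarrow> _")
proof -
  have eq: "stack h \<bullet> (?M *v stack k) = omega (\<phi>' h) (\<phi>' k)" for h k
  proof -
    have adj: "x \<bullet> (transpose A *v y) = (A *v x) \<bullet> y" for A :: "real ^ 'n::finite ^ 'm::finite" and x y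
      using dot_lmul_matrix[of y A x] by (simp add: transpose_matrix_vector inner_commute)
    have "?M *v stack k = transpose (phase_jacobian \<phi> z) *v (J_matrix *v (phase_jacobian \<phi> z *v stack k))"
      by (simp add: matrix_vector_mul_assoc matrix_mul_assoc)
    then show ?thesis
      by (simp only: adj phase_jacobian_stack[OF assms] stack_inner_J_matrix)
  qed
  have "?M = J_matrix \<longleftrightarrow> (\<forall>h k. stack h \<bullet> (?M *v stack k) = stack h \<bullet> (J_matrix *v stack k))"
  proof (intro iffI)
    assume *: "\<forall>h k. stack h \<bullet> (?M *v stack k) = stack h \<bullet> (J_matrix *v stack k)"
    have "x \<bullet> (?M *v y) = x \<bullet> (J_matrix *v y)" for x y
      using *[rule_format, of "unstack x" "unstack y"] by simp
    then have "?M *v y = J_matrix *v y" for y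
      using vector_eq_ldot by blast
    then show "?M = J_matrix"
      using matrix_eq by blast
  qed simp
  then show ?thesis by (simp add: eq stack_inner_J_matrix)
qed

text \<open>The norm of a matrix here is the Frobenius norm, so the Cauchy-Schwarz inequality in
  each row gives the bound.\<close>

lemma norm_matrix_vector_mult_le: "norm (A *v x) \<le> norm A * norm x" for A :: "real ^ 'n ^ 'm"
proof -
  have "norm (A *v x) \<le> L2_set (\<lambda>i. norm (A $ i) * norm x) UNIV"
    unfolding norm_vec_def[of "A *v x"]
    by (rule L2_set_mono) (simp_all add: matrix_vector_mul_component Cauchy_Schwarz_ineq2)
  also have "\<dots> = norm A * norm x"
    by (simp add: norm_vec_def[of A] L2_set_left_distrib)
  finally show ?thesis .
qed

subsection \<open>Generating functions\<close>

text \<open>The linear map \<open>T\<close> with \<open>u = p + l (P - p)\<close> and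
  \<open>v = q + (1 - l) (Q - q)\<close>.\<close>

definition skew_scale :: "real \<Rightarrow> 'd::finite phase \<Rightarrow> 'd phase" where
  "skew_scale l a = (l *\<^sub>R fst a, (1 - l) *\<^sub>R snd a)"

definition uv_map :: "real \<Rightarrow> ('d::finite phase \<Rightarrow> 'd phase) \<Rightarrow> 'd phase \<Rightarrow> 'd phase" where
  "uv_map l \<phi> z = (u_var l \<phi> z, v_var l \<phi> z)"

lemma uv_map_eq: "uv_map l \<phi> z = z + skew_scale l (\<phi> z - z)"
  by (simp add: uv_map_def u_var_def v_var_def skew_scale_def prod_eq_iff algebra_simps)

lemma bounded_linear_skew_scale: "bounded_linear (skew_scale l)"
  unfolding skew_scale_def[abs_def]
  by (intro bounded_linear_Pair bounded_linear_compose[OF bounded_linear_scaleR_right]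
      bounded_linear_fst bounded_linear_snd)

lemma norm_skew_scale_le: "norm (skew_scale l a) \<le> (\<bar>l\<bar> + \<bar>1 - l\<bar>) * norm a"
proof -
  have "norm (skew_scale l a) \<le> norm (l *\<^sub>R fst a) + norm ((1 - l) *\<^sub>R snd a)"
    unfolding skew_scale_def by (rule norm_Pair_le)
  also have "\<dots> \<le> \<bar>l\<bar> * norm a + \<bar>1 - l\<bar> * norm a"
    using norm_fst_le[of "fst a" "snd a"] norm_snd_le[of "snd a" "fst a"]
    by (auto intro!: add_mono mult_left_mono)
  finally show ?thesis by (simp add: algebra_simps)
qed

lemma smooth_on_displacement: "open D \<Longrightarrow> smooth_on D \<phi> \<Longrightarrow> smooth_on D (\<lambda>z. \<phi> z - z)"
  using smooth_on_add[of D \<phi> "\<lambda>z. - z"]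
    smooth_on_bounded_linear[OF _ bounded_linear_minus[OF bounded_linear_ident] smooth_on_ident, of D]
  by simp

lemma smooth_on_uv_map:
  assumes "open D" "smooth_on D \<phi>"
  shows "smooth_on D (uv_map l \<phi>)"
proof -
  have "smooth_on D (\<lambda>z. z + skew_scale l (\<phi> z - z))"
    by (intro smooth_on_add smooth_on_ident smooth_on_bounded_linear[OF _ bounded_linear_skew_scale]
        smooth_on_displacement assms)
  then show ?thesis by (simp add: uv_map_eq[abs_def])
qed

lemma uv_map_has_derivative:
  assumes "(\<phi> has_derivative \<phi>') (at z)"
  shows "(uv_map l \<phi> has_derivative (\<lambda>h. h + skew_scale l (\<phi>' h - h))) (at z)"
  unfolding uv_map_eq[abs_def]
  by (intro has_derivative_add has_derivative_ident bounded_linear.has_derivative[OF bounded_linear_skew_scale]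
      has_derivative_diff assms)

lemma gen_form_eq:
  assumes "(\<phi> has_derivative \<phi>') (at z)"
  shows "gen_form l \<phi> z h = - omega (\<phi> z - z) (h + skew_scale l (\<phi>' h - h))"
proof -
  note g = uv_map_has_derivative[OF assms, of l]
  have "frechet_derivative (u_var l \<phi>) (at z) h = fst (h + skew_scale l (\<phi>' h - h))"
    using fun_cong[OF frechet_derivative_at[OF has_derivative_fst[OF g]], of h]
    by (simp add: uv_map_def)
  moreover have "frechet_derivative (v_var l \<phi>) (at z) h = snd (h + skew_scale l (\<phi>' h - h))"
    using fun_cong[OF frechet_derivative_at[OF has_derivative_snd[OF g]], of h]
    by (simp add: uv_map_def)
  ultimately show ?thesis
    by (simp add: gen_form_def omega_def del: fst_add snd_add)
qed

text \<open>
  The terms quadratic in \<open>(a, b)\<close> contribute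
  \<^term>\<open>omega b (skew_scale l a) - omega a (skew_scale l b) = omega b a\<close>, from which \<open>l\<close> has cancelled.
\<close>

lemma omega_skew_scale:
  "omega b (h + skew_scale l a) = omega a (k + skew_scale l b) \<longleftrightarrow>
    omega (h + a) (k + b) = omega h k"
proof -
  have "omega b (h + skew_scale l a) - omega a (k + skew_scale l b) = omega h k - omega (h + a) (k + b)"
    by (simp add: omega_def skew_scale_def inner_add_left inner_add_right inner_commute algebra_simps)
  then show ?thesis by auto
qed

text \<open>The product rule applied to \<open>gen_form_eq\<close>, with \<open>h\<close> the
  argument of the form and \<open>k\<close> the direction of differentiation. Only the first summand
  contains second derivatives of \<open>\<phi>\<close>.\<close>

definition gen_form_deriv :: "real \<Rightarrow> ('d::finite phase \<Rightarrow> 'd phase) \<Rightarrow> 'd phase \<Rightarrow> 'd phase \<Rightarrow> 'd phase \<Rightarrow> real" where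
  "gen_form_deriv l \<phi> z h k =
    - (omega (\<phi> z - z) (skew_scale l (frechet_derivative (\<lambda>z. frechet_derivative \<phi> (at z) h) (at z) k)) +
       omega (frechet_derivative \<phi> (at z) k - k) (h + skew_scale l (frechet_derivative \<phi> (at z) h - h)))"

lemma gen_form_has_derivative:
  assumes "open D" "smooth_on D \<phi>" "z \<in> D"
  shows "((\<lambda>z. gen_form l \<phi> z h) has_derivative gen_form_deriv l \<phi> z h) (at z)"
proof -
  let ?\<phi>' = "\<lambda>z h. frechet_derivative \<phi> (at z) h"
  let ?\<phi>'' = "\<lambda>z h k. frechet_derivative (\<lambda>z. ?\<phi>' z h) (at z) k"
  have "((\<lambda>z. \<phi> z - z) has_derivative (\<lambda>k. ?\<phi>' z k - k)) (at z)"
    by (intro has_derivative_diff smooth_on_has_derivative[OF assms(2,3)] has_derivative_ident)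
  moreover have "((\<lambda>z. h + skew_scale l (?\<phi>' z h - h)) has_derivative (\<lambda>k. 0 + skew_scale l (?\<phi>'' z h k - 0))) (at z)"
    by (intro has_derivative_add has_derivative_const has_derivative_diff
        smooth_on_has_derivative[OF smooth_on_frechet[OF assms(2)] assms(3)]
        bounded_linear.has_derivative[OF bounded_linear_skew_scale])
  ultimately have "((\<lambda>z. - omega (\<phi> z - z) (h + skew_scale l (?\<phi>' z h - h))) has_derivative
      (\<lambda>k. - (omega (\<phi> z - z) (0 + skew_scale l (?\<phi>'' z h k - 0)) +
        omega (?\<phi>' z k - k) (h + skew_scale l (?\<phi>' z h - h))))) (at z)"
    by (intro has_derivative_minus bounded_bilinear.FDERIV[OF bounded_bilinear_omega])
  then have "((\<lambda>z. - omega (\<phi> z - z) (h + skew_scale l (?\<phi>' z h - h))) has_derivative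
      gen_form_deriv l \<phi> z h) (at z)"
    by (simp add: gen_form_deriv_def[abs_def])
  then show ?thesis
    by (rule has_derivative_transform_within_open[OF _ assms(1,3)])
       (rule gen_form_eq[OF smooth_on_has_derivative[OF assms(2)], symmetric])
qed

lemma continuous_on_gen_form_deriv:
  assumes "open D" "smooth_on D \<phi>"
  shows "continuous_on D (\<lambda>z. gen_form_deriv l \<phi> z h k)"
proof -
  have "continuous_on D (\<lambda>z. frechet_derivative \<phi> (at z) h)" for h
    by (intro smooth_on_continuous smooth_on_frechet assms)
  moreover have "continuous_on D (\<lambda>z. frechet_derivative (\<lambda>z. frechet_derivative \<phi> (at z) h) (at z) k)"
    by (intro smooth_on_continuous smooth_on_frechet assms)
  moreover have "continuous_on D \<phi>"
    using assms(2) by (rule smooth_on_continuous)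
  ultimately show ?thesis
    unfolding gen_form_deriv_def
    by (intro continuous_intros bounded_bilinear.continuous_on[OF bounded_bilinear_omega]
        bounded_linear.continuous_on[OF bounded_linear_skew_scale])
qed

text \<open>The second-derivative terms agree on both sides by Schwarz's theorem. What remains is
  \<open>omega_skew_scale\<close>, with \<open>a\<close> and \<open>b\<close> the values of
  \<open>\<phi>' - id\<close> on \<open>h\<close> and \<open>k\<close>, so that \<open>h + a\<close>
  and \<open>k + b\<close> are the images under \<open>\<phi>'\<close>.\<close>

lemma gen_form_deriv_symmetric_iff:
  assumes "open D" "smooth_on D \<phi>" "z \<in> D"
  shows "gen_form_deriv l \<phi> z h k = gen_form_deriv l \<phi> z k h \<longleftrightarrow>
    omega (frechet_derivative \<phi> (at z) h) (frechet_derivative \<phi> (at z) k) = omega h k"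
  using omega_skew_scale[of "frechet_derivative \<phi> (at z) k - k" h l "frechet_derivative \<phi> (at z) h - h" k]
  by (simp add: gen_form_deriv_def smooth_on_second_derivative_symmetric[OF assms, of k h])

lemma smooth_on_gen_form:
  assumes "open D" "smooth_on D \<phi>"
  shows "smooth_on D (\<lambda>z. gen_form l \<phi> z h)"
proof (rule smooth_on_cong[OF assms(1)])
  let ?\<phi>' = "\<lambda>z h. frechet_derivative \<phi> (at z) h"
  have "smooth_on D (\<lambda>z. ?\<phi>' z h - h)"
    using smooth_on_add[OF assms(1) smooth_on_frechet[OF assms(2), of h] smooth_on_const[of D "- h"]] by simp
  then show "smooth_on D (\<lambda>z. - omega (\<phi> z - z) (h + skew_scale l (?\<phi>' z h - h)))"
    by (intro smooth_on_bounded_linear[OF _ bounded_linear_minus[OF bounded_linear_ident]]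
        smooth_on_bilinear[OF _ bounded_bilinear_omega] smooth_on_add smooth_on_const
        smooth_on_bounded_linear[OF _ bounded_linear_skew_scale] smooth_on_displacement assms)
  show "- omega (\<phi> z - z) (h + skew_scale l (?\<phi>' z h - h)) = gen_form l \<phi> z h" if "z \<in> D" for z
    by (rule gen_form_eq[OF smooth_on_has_derivative[OF assms(2) that], symmetric])
qed

lemma linear_gen_form:
  assumes "(\<phi> has_derivative \<phi>') (at z)"
  shows "linear (gen_form l \<phi> z)"
proof -
  have "bounded_linear (\<lambda>h. - omega (\<phi> z - z) (h + skew_scale l (\<phi>' h - h)))"
    using has_derivative_bounded_linear[OF assms]
    by (intro bounded_linear_minus bounded_linear_compose[OF bounded_bilinear.bounded_linear_right[OF bounded_bilinear_omega]]
        bounded_linear_add bounded_linear_ident bounded_linear_compose[OF bounded_linear_skew_scale] bounded_linear_sub)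
  then show ?thesis
    by (simp add: gen_form_eq[OF assms, abs_def] bounded_linear.linear)
qed

section \<open>Closeness to the identity and the two implications\<close>

lemma close_to_identity_imp_uv_map_near_identity:
  assumes "close_to_identity_on \<epsilon> D \<phi>" "z \<in> D" "(\<phi> has_derivative \<phi>') (at z)"
    and "(\<bar>l\<bar> + \<bar>1 - l\<bar>) * \<epsilon> \<le> c"
  shows "norm ((h + skew_scale l (\<phi>' h - h)) - h) \<le> c * norm h"
proof -
  have "norm (\<phi>' h - h) = norm ((phase_jacobian \<phi> z - mat 1) *v stack h)"
    by (simp add: matrix_vector_mult_diff_rdistrib phase_jacobian_stack[OF assms(3)]
        linear_diff[OF linear_stack, symmetric] norm_stack)
  also have "\<dots> \<le> norm (phase_jacobian \<phi> z - mat 1) * norm h"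
    using norm_matrix_vector_mult_le[of _ "stack h"] by (simp add: norm_stack)
  also have "\<dots> \<le> \<epsilon> * norm h"
    using assms(1,2) by (intro mult_right_mono) (auto simp: close_to_identity_on_def less_imp_le)
  finally have "norm (skew_scale l (\<phi>' h - h)) \<le> (\<bar>l\<bar> + \<bar>1 - l\<bar>) * (\<epsilon> * norm h)"
    by (intro order_trans[OF norm_skew_scale_le] mult_left_mono) auto
  also have "\<dots> \<le> c * norm h"
    using mult_right_mono[OF assms(4), of "norm h"] by (simp add: mult.assoc)
  finally show ?thesis by simp
qed

text \<open>The composite of \<open>S\<close> with \<open>(u, v)\<close> is a primitive of the
  one-form near \<open>z\<close>, so the derivative of the form is symmetric there.\<close>

lemma generating_function_imp_symplectic:
  assumes "open D" "smooth_on D \<phi>" "locally_has_generating_function l D \<phi>"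
  shows "symplectic_on D \<phi>"
  unfolding symplectic_on_def
proof
  fix z assume z: "z \<in> D"
  obtain U S where U: "open U" "z \<in> U" "U \<subseteq> D" and
    S: "\<forall>z\<in>U. ((\<lambda>z. S (u_var l \<phi> z, v_var l \<phi> z)) has_derivative gen_form l \<phi> z) (at z)"
    using bspec[OF assms(3)[unfolded locally_has_generating_function_def] z]
    by (elim exE conjE) (rule that)
  have der: "((\<lambda>z. gen_form l \<phi> z h) has_derivative gen_form_deriv l \<phi> z h) (at z)" if "z \<in> U" for z h
    using U(3) that by (intro gen_form_has_derivative[OF assms(1,2)]) auto
  have cont: "continuous_on U (\<lambda>z. gen_form_deriv l \<phi> z h k)" for h k
    using continuous_on_gen_form_deriv[OF assms(1,2)] U(3) by (rule continuous_on_subset)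
  have "omega (frechet_derivative \<phi> (at z) h) (frechet_derivative \<phi> (at z) k) = omega h k" for h k
    by (rule iffD1[OF gen_form_deriv_symmetric_iff[OF assms(1,2) z, of l]
        exact_imp_symmetric_derivative[OF U(1,2) bspec[OF S] der cont]])
  then show "transpose (phase_jacobian \<phi> z) ** J_matrix ** phase_jacobian \<phi> z = J_matrix"
    unfolding symplectic_iff_omega[OF smooth_on_has_derivative[OF assms(2) z]] by blast
qed

lemma symplectic_imp_generating_function:
  fixes \<phi> :: "'d::finite phase \<Rightarrow> 'd phase"
  assumes "open D" "smooth_on D \<phi>" "symplectic_on D \<phi>"
    and near: "\<And>z h. z \<in> D \<Longrightarrow> norm (frechet_derivative (uv_map l \<phi>) (at z) h - h) \<le> 1/2 * norm h"
  shows "locally_has_generating_function l D \<phi>"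
  unfolding locally_has_generating_function_def
proof
  fix z0 assume "z0 \<in> D"
  then obtain r where r: "r > 0" "ball z0 r \<subseteq> D"
    using assms(1) open_contains_ball by blast
  \<comment> \<open>A ball is convex, as required both for the primitive and for injectivity of
    \<open>g\<close>.\<close>
  define U where "U = ball z0 r"
  have U: "open U" "convex U" "z0 \<in> U" "U \<subseteq> D"
    using r by (auto simp: U_def)
  have lin: "linear (gen_form l \<phi> z)" if "z \<in> U" for z
    using U(4) that by (intro linear_gen_form[OF smooth_on_has_derivative[OF assms(2)]]) auto
  have sym: "gen_form_deriv l \<phi> z h k = gen_form_deriv l \<phi> z k h" if "z \<in> U" for z h k
  proof -
    have z: "z \<in> D" using that U(4) by blast
    then have "transpose (phase_jacobian \<phi> z) ** J_matrix ** phase_jacobian \<phi> z = J_matrix"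
      using assms(3) by (simp add: symplectic_on_def)
    then have "omega (frechet_derivative \<phi> (at z) h) (frechet_derivative \<phi> (at z) k) = omega h k"
      unfolding symplectic_iff_omega[OF smooth_on_has_derivative[OF assms(2) z]] by blast
    then show ?thesis by (rule iffD2[OF gen_form_deriv_symmetric_iff[OF assms(1,2) z]])
  qed
  have der: "((\<lambda>z. gen_form l \<phi> z h) has_derivative gen_form_deriv l \<phi> z h) (at z)" if "z \<in> U" for z h
    using U(4) that by (intro gen_form_has_derivative[OF assms(1,2)]) auto
  have cont: "continuous_on U (\<lambda>z. gen_form_deriv l \<phi> z h k)" for h k
    using continuous_on_gen_form_deriv[OF assms(1,2)] U(4) by (rule continuous_on_subset)
  obtain f where f: "\<And>z. z \<in> U \<Longrightarrow> (f has_derivative gen_form l \<phi> z) (at z)"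
  proof (rule symmetric_derivative_imp_exact[OF U(1,2) lin der cont sym])
    fix f assume "\<And>z. z \<in> U \<Longrightarrow> (f has_derivative gen_form l \<phi> z) (at z)"
    then show thesis by (rule that)
  qed
  define g where "g = uv_map l \<phi>"
  have smooth_g: "smooth_on U g"
    unfolding g_def using smooth_on_uv_map[OF assms(1,2)] U(4) by (rule smooth_on_subset)
  have near_g: "norm (frechet_derivative g (at z) h - h) \<le> 1/2 * norm h" if "z \<in> U" for z h
    unfolding g_def using U(4) that by (intro near) auto
  have inj: "inj_on g U"
    by (rule near_identity_injective[OF U(2) _ smooth_on_has_derivative[OF smooth_g] near_g]) auto
  \<comment> \<open>The reverse triangle inequality leaves \<open>1 - 1/2\<close> as lower bound,
    which supplies the constant for smoothness of the inverse of \<open>g\<close>.\<close>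
  have below: "1/2 * norm h \<le> norm (frechet_derivative g (at z) h)" if "z \<in> U" for z h
    using near_g[OF that, of h] norm_triangle_ineq2[of h "h - frechet_derivative g (at z) h"]
    by (simp add: norm_minus_commute)
  have smooth_f: "smooth_on U f"
    by (rule smooth_onI[OF U(1) f smooth_on_subset[OF smooth_on_gen_form[OF assms(1,2)] U(4)]])
  define S where "S y = f (inv_into U g y)" for y
  have "open (g ` U)"
    using smooth_on_continuous[OF smooth_g] U(1) inj by (rule invariance_of_domain)
  moreover have "smooth_on (g ` U) S"
    unfolding S_def by (rule smooth_on_compose_inv_into[OF U(1) inj smooth_g _ below smooth_f]) auto
  moreover have "((\<lambda>z. S (u_var l \<phi> z, v_var l \<phi> z)) has_derivative gen_form l \<phi> z) (at z)" if "z \<in> U" for z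
  proof (rule has_derivative_transform_within_open[OF f[OF that] U(1) that])
    show "f x = S (u_var l \<phi> x, v_var l \<phi> x)" if "x \<in> U" for x
      using inv_into_f_f[OF inj that] by (simp add: S_def g_def uv_map_def)
  qed
  moreover have "(u_var l \<phi> z, v_var l \<phi> z) \<in> g ` U" if "z \<in> U" for z
    using that by (auto simp: g_def uv_map_def)
  ultimately show "\<exists>U W. \<exists>S :: 'd phase \<Rightarrow> real.
        open U \<and> z0 \<in> U \<and> U \<subseteq> D \<and>
        open W \<and> (\<forall>z\<in>U. (u_var l \<phi> z, v_var l \<phi> z) \<in> W) \<and> smooth_on W S \<and>
        (\<forall>z\<in>U. ((\<lambda>z. S (u_var l \<phi> z, v_var l \<phi> z)) has_derivative gen_form l \<phi> z) (at z))"
    using U by (intro exI[of _ U] exI[of _ "g ` U"] exI[of _ S]) simp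
qed

theorem theorem2p1:
  fixes l :: real
  shows "\<exists>\<epsilon>>0. \<forall>(D :: 'd::finite phase set) (\<phi> :: 'd phase \<Rightarrow> 'd phase).
    open D \<and> smooth_on D \<phi> \<and> close_to_identity_on \<epsilon> D \<phi> \<longrightarrow>
      (symplectic_on D \<phi> \<longleftrightarrow> locally_has_generating_function l D \<phi>)"
proof -
  \<comment> \<open>\<open>C\<close> bounds the norm of \<open>skew_scale l\<close> and is positive
    because \<open>l\<close> and \<open>1 - l\<close> cannot both vanish. Taking \<epsilon> as
    \<open>1 / (2 * C)\<close> puts the derivative of \<open>uv_map l \<phi>\<close> within 1/2 of
    the identity, and this \<epsilon> depends on \<open>l\<close> alone.\<close>
  define C where "C = \<bar>l\<bar> + \<bar>1 - l\<bar>"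
  have "C > 0" by (auto simp: C_def)
  have "symplectic_on D \<phi> \<longleftrightarrow> locally_has_generating_function l D \<phi>"
    if "open D" and smooth: "smooth_on D \<phi>" and close: "close_to_identity_on (1 / (2 * C)) D \<phi>"
    for D :: "'d phase set" and \<phi>
  proof
    assume "symplectic_on D \<phi>"
    with that(1,2) show "locally_has_generating_function l D \<phi>"
    proof (rule symplectic_imp_generating_function)
      fix z h assume z: "z \<in> D"
      note d = smooth_on_has_derivative[OF smooth z]
      have "(\<bar>l\<bar> + \<bar>1 - l\<bar>) * (1 / (2 * C)) \<le> 1/2"
        using \<open>C > 0\<close> by (simp add: C_def[symmetric])
      from close_to_identity_imp_uv_map_near_identity[OF close z d this]
      show "norm (frechet_derivative (uv_map l \<phi>) (at z) h - h) \<le> 1/2 * norm h"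
        by (simp only: frechet_derivative_at[OF uv_map_has_derivative[OF d, of l], symmetric])
    qed
  qed (rule generating_function_imp_symplectic[OF that(1,2)])
  with \<open>C > 0\<close> show ?thesis
    by (intro exI[of _ "1 / (2 * C)"]) auto
qed

end
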